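(* There is a universal constant $C>0$ such that for every fixed integer $m>1$ and every integer $n'\ge 2m-2$, there are at least $$C\,\frac{2^{\sqrt{2m-2}}}{(2m-2)^{1/4}}$$ different (pairwise non-isomorphic) locally $\frac{n'-m}{n'}$-stable functions on $\{-1,1\}^{n'}$.
   Context: For each $N\ge 1$, the hypercube $\{-1,1\}^N$ is regarded as a graph in which two vertices are adjacent iff they differ in exactly one coordinate. A function $f:\{-1,1\}^N\to\{-1,1\}$ is locally $p$-stable if for every vertex $x$, $|\{y\sim x : f(y)=f(x)\}|/N = p$. Two functions $f,g:\{-1,1\}^N\to\{-1,1\}$ are isomorphic if there is a graph automorphism $\psi$ of $\{-1,1\}^N$ with $f\circ\psi=g$, and non-isomorphic otherwise. *)

theory Defs
  imports Complex_Main "HOL-Library.FuncSet"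
begin

(* The dimension N varies inside the theorem, so points of {-1,1}^N are extensional
   functions on {..<N}; each point then has exactly one representative. *)
definition hypercube :: "nat \<Rightarrow> (nat \<Rightarrow> int) set" where
  "hypercube N = {..<N} \<rightarrow>\<^sub>E {-1, 1}"

definition adjacent :: "nat \<Rightarrow> (nat \<Rightarrow> int) \<Rightarrow> (nat \<Rightarrow> int) \<Rightarrow> bool" where
  "adjacent N x y \<longleftrightarrow> x \<in> hypercube N \<and> y \<in> hypercube N \<and> card {i \<in> {..<N}. x i \<noteq> y i} = 1"

definition boolean_functions :: "nat \<Rightarrow> ((nat \<Rightarrow> int) \<Rightarrow> int) set" where
  "boolean_functions N = hypercube N \<rightarrow>\<^sub>E {-1, 1}"

definition locally_stable :: "nat \<Rightarrow> real \<Rightarrow> ((nat \<Rightarrow> int) \<Rightarrow> int) \<Rightarrow> bool" where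
  "locally_stable N p f \<longleftrightarrow>
     (\<forall>x\<in>hypercube N. real (card {y. adjacent N x y \<and> f y = f x}) / real N = p)"

definition cube_automorphism :: "nat \<Rightarrow> ((nat \<Rightarrow> int) \<Rightarrow> (nat \<Rightarrow> int)) \<Rightarrow> bool" where
  "cube_automorphism N \<psi> \<longleftrightarrow>
     bij_betw \<psi> (hypercube N) (hypercube N) \<and>
     (\<forall>x\<in>hypercube N. \<forall>y\<in>hypercube N. adjacent N (\<psi> x) (\<psi> y) \<longleftrightarrow> adjacent N x y)"

definition isomorphic :: "nat \<Rightarrow> ((nat \<Rightarrow> int) \<Rightarrow> int) \<Rightarrow> ((nat \<Rightarrow> int) \<Rightarrow> int) \<Rightarrow> bool" where
  "isomorphic N f g \<longleftrightarrow>
     (\<exists>\<psi>. cube_automorphism N \<psi> \<and> (\<forall>x\<in>hypercube N. f (\<psi> x) = g x))"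

end

theory Submission
  imports Defs
begin

text \<open>Call a direction sensitive at a vertex if moving in that direction changes the value of \<open>f\<close>.
  Local \<open>(N - m) / N\<close>-stability says that every vertex has exactly \<open>m\<close> sensitive directions.  This number
  adds up over products of functions of disjoint sets of coordinates.  The building
  blocks are \<open>a * x\<close> and \<open>a * (if a = b then x else y)\<close>, where \<open>a\<close> and \<open>b\<close> are products of \<open>t\<close>
  coordinates each and \<open>x\<close>, \<open>y\<close> are two more coordinates; both live on \<open>2 t + 2\<close> coordinates and both
  have exactly \<open>t + 1\<close> sensitive directions everywhere (\<open>card_holds_block\<close>).  Hence one can place
  blocks for all \<open>t < K\<close> next to each other, choose for every \<open>t \<ge> 2\<close> one of the two kinds, and
  multiply by further coordinates until the number of sensitive directions is \<open>m\<close>.  The choice is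
  recorded by the set \<open>S\<close> of those \<open>t\<close> whose block is of the second kind.

  The set \<open>S\<close> is an isomorphism invariant.  Call two directions twins if they are sensitive at the
  same vertices.  An automorphism of the cube permutes the directions (\<open>automorphism_directions\<close>),
  so the sizes of the twin classes of directions that are sensitive at some but not all
  vertices are preserved (\<open>twin_sizes_isomorphic\<close>).  In a block of the second kind these classes are
  the coordinates of \<open>a\<close>, those of \<open>b\<close>, \<open>{x}\<close> and \<open>{y}\<close>, of sizes \<open>t\<close>, \<open>t\<close>, 1, 1; all other
  directions are sensitive always or never.  So a size \<open>t\<close> of at least 2 occurs exactly if \<open>t\<close>
  belongs to \<open>S\<close> (\<open>S_recovered\<close>).

  The blocks occupy \<open>K (K + 1)\<close> coordinates and contribute half as many sensitive directions, so
  \<open>m + K (K + 1) / 2\<close> coordinates suffice, and \<open>K (K + 1) \<le> 2 m - 4\<close> makes this at most \<open>2 m - 2\<close>.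
  The largest such \<open>K\<close> is at least \<open>sqrt (2 m - 2) - 3\<close>, and there are \<open>2 ^ (K - 2)\<close> sets \<open>S\<close> of
  numbers \<open>t\<close> with \<open>2 \<le> t < K\<close>.\<close>

section \<open>Directions of the cube and their sensitivity\<close>

definition flip :: "nat \<Rightarrow> (nat \<Rightarrow> int) \<Rightarrow> nat \<Rightarrow> int" where
  "flip i x = x(i := - x i)"

lemma flip_apply: "flip i x j = (if j = i then - x i else x j)"
  by (simp add: flip_def)

lemma flip_flip [simp]: "flip i (flip i x) = x"
  by (auto simp: flip_def)

lemma hypercube_value:
  assumes "x \<in> hypercube N" "i < N"
  shows "x i = 1 \<or> x i = -1"
  using assms by (auto simp: hypercube_def dest!: PiE_mem[where x = i])

lemma flip_in_hypercube [simp]: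
  assumes "x \<in> hypercube N" "i < N"
  shows "flip i x \<in> hypercube N"
  using assms hypercube_value[OF assms]
  by (auto simp: hypercube_def PiE_iff extensional_def flip_apply)

lemma flip_inject:
  assumes "x \<in> hypercube N" "i < N" "flip i x = flip j x"
  shows "i = j"
proof (rule ccontr)
  assume "i \<noteq> j"
  then have "- x i = x i"
    using fun_cong[OF assms(3), of i] by (simp add: flip_apply)
  then show False using hypercube_value[OF assms(1,2)] by auto
qed

lemma adjacent_iff_flip:
  "adjacent N x y \<longleftrightarrow> x \<in> hypercube N \<and> (\<exists>i<N. y = flip i x)"
proof (intro iffI conjI)
  assume adj: "adjacent N x y"
  then show xH: "x \<in> hypercube N" by (simp add: adjacent_def)
  have yH: "y \<in> hypercube N" using adj by (simp add: adjacent_def)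
  obtain i where i: "{i \<in> {..<N}. x i \<noteq> y i} = {i}"
    using adj unfolding adjacent_def by (auto simp: card_1_singleton_iff)
  then have "i < N" "x i \<noteq> y i" by blast+
  moreover have "y j = x j" if "j \<noteq> i" for j
  proof (cases "j < N")
    case True
    have "j \<notin> {i \<in> {..<N}. x i \<noteq> y i}" unfolding i using that by simp
    then show ?thesis using True by simp
  next
    case False
    then show ?thesis using PiE_arb[of x] PiE_arb[of y] xH yH by (simp add: hypercube_def)
  qed
  moreover have "y i = - x i"
    using hypercube_value[OF xH \<open>i < N\<close>] hypercube_value[OF yH \<open>i < N\<close>] \<open>x i \<noteq> y i\<close> by auto
  ultimately have "y = flip i x" by (intro ext) (simp add: flip_apply)
  then show "\<exists>i<N. y = flip i x" using \<open>i < N\<close> by blast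
next
  assume "x \<in> hypercube N \<and> (\<exists>i<N. y = flip i x)"
  then obtain i where xH: "x \<in> hypercube N" and i: "i < N" "y = flip i x" by auto
  have "{j \<in> {..<N}. x j \<noteq> y j} = {i}"
    using hypercube_value[OF xH i(1)] i(1) unfolding i(2) by (auto simp: flip_apply)
  then show "adjacent N x y" using xH i by (simp add: adjacent_def)
qed

definition sensitive :: "((nat \<Rightarrow> int) \<Rightarrow> int) \<Rightarrow> (nat \<Rightarrow> int) \<Rightarrow> nat \<Rightarrow> bool" where
  "sensitive f x i \<longleftrightarrow> f (flip i x) \<noteq> f x"

lemma locally_stable_if_constant_sensitivity:
  assumes "\<And>x. x \<in> hypercube N \<Longrightarrow> card {i \<in> {..<N}. sensitive f x i} = m"
  shows "locally_stable N ((real N - real m) / real N) f"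
  unfolding locally_stable_def
proof
  fix x assume xH: "x \<in> hypercube N"
  let ?A = "{i \<in> {..<N}. sensitive f x i}"
  have "{y. adjacent N x y \<and> f y = f x} = (\<lambda>i. flip i x) ` ({..<N} - ?A)"
    using xH by (auto simp: adjacent_iff_flip sensitive_def)
  moreover have "inj_on (\<lambda>i. flip i x) ({..<N} - ?A)"
    using flip_inject[OF xH] by (auto simp: inj_on_def)
  ultimately have "card {y. adjacent N x y \<and> f y = f x} = card ({..<N} - ?A)"
    by (simp add: card_image)
  also have "\<dots> = N - m"
    using assms[OF xH] by (subst card_Diff_subset) auto
  finally have "card {y. adjacent N x y \<and> f y = f x} = N - m" .
  moreover have "m \<le> N"
    using card_mono[of "{..<N}" ?A] assms[OF xH] by auto
  ultimately show "real (card {y. adjacent N x y \<and> f y = f x}) / real N = (real N - real m) / real N"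
    by (simp add: of_nat_diff)
qed

section \<open>Automorphisms permute the directions\<close>

lemma hypercube_connected:
  assumes base: "\<And>x. x \<in> hypercube N \<Longrightarrow> (\<forall>i<N. x i = 1) \<Longrightarrow> P x"
    and step: "\<And>x i. x \<in> hypercube N \<Longrightarrow> i < N \<Longrightarrow> P x \<Longrightarrow> P (flip i x)"
    and "x \<in> hypercube N"
  shows "P x"
  using \<open>x \<in> hypercube N\<close>
proof (induction "card {i \<in> {..<N}. x i \<noteq> 1}" arbitrary: x rule: less_induct)
  case less
  show ?case
  proof (cases "\<forall>i<N. x i = 1")
    case True then show ?thesis using base less by blast
  next
    case False
    then obtain i where i: "i < N" "x i \<noteq> 1" by auto
    then have "x i = -1" using hypercube_value less.prems by blast
    then have "{j \<in> {..<N}. flip i x j \<noteq> 1} = {j \<in> {..<N}. x j \<noteq> 1} - {i}"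
      by (auto simp: flip_apply)
    then have "card {j \<in> {..<N}. flip i x j \<noteq> 1} < card {j \<in> {..<N}. x j \<noteq> 1}"
      using i by (simp add: card_Diff1_less del: card_Diff_insert)
    then have "P (flip i x)" using less.hyps less.prems i(1) flip_in_hypercube by blast
    then have "P (flip i (flip i x))" using step[OF flip_in_hypercube] less.prems i(1) by blast
    then show ?thesis by simp
  qed
qed

text \<open>At each vertex the automorphism induces a bijection of directions.  It is the same at
  adjacent vertices: the two remaining sides of a square are determined by the two given ones,
  because two vertices at distance 2 have only two common neighbours.  Connectedness of the cube
  does the rest.\<close>

lemma automorphism_directions:
  assumes aut: "cube_automorphism N \<psi>"
  obtains \<pi> where "bij_betw \<pi> {..<N} {..<N}"
    "\<And>x i. x \<in> hypercube N \<Longrightarrow> i < N \<Longrightarrow> \<psi> (flip i x) = flip (\<pi> i) (\<psi> x)"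
proof -
  have bij: "bij_betw \<psi> (hypercube N) (hypercube N)"
    using aut by (simp add: cube_automorphism_def)
  have mem: "\<psi> x \<in> hypercube N" if "x \<in> hypercube N" for x
    using bij that by (auto simp: bij_betw_def)
  have inj: "x = y" if "x \<in> hypercube N" "y \<in> hypercube N" "\<psi> x = \<psi> y" for x y
    using bij that by (auto simp: bij_betw_def inj_on_def)
  have "\<exists>k<N. \<psi> (flip i x) = flip k (\<psi> x)" if "x \<in> hypercube N" "i < N" for x i
  proof -
    have "adjacent N x (flip i x)" using that by (auto simp: adjacent_iff_flip)
    then have "adjacent N (\<psi> x) (\<psi> (flip i x))"
      using aut that by (auto simp: cube_automorphism_def)
    then show ?thesis by (simp add: adjacent_iff_flip)
  qed
  then obtain \<rho> where \<rho>: "\<And>x i. x \<in> hypercube N \<Longrightarrow> i < N \<Longrightarrow>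
      \<rho> x i < N \<and> \<psi> (flip i x) = flip (\<rho> x i) (\<psi> x)"
    by metis
  have \<rho>_inj: "i = j" if "x \<in> hypercube N" "i < N" "j < N" "\<rho> x i = \<rho> x j" for x i j
  proof -
    have "\<psi> (flip i x) = \<psi> (flip j x)" using \<rho> that by simp
    then have "flip i x = flip j x" using inj that by simp
    then show ?thesis using flip_inject that by blast
  qed
  \<comment> \<open>With \<open>i \<noteq> j\<close>, the two paths around the square at \<open>x\<close> end at the same vertex, which is not \<open>x\<close>.\<close>
  have local: "\<rho> (flip i x) j = \<rho> x j" if x: "x \<in> hypercube N" and ij: "i < N" "j < N" for x i j
  proof (cases "i = j")
    case True
    have "\<psi> (flip i (flip i x)) = flip (\<rho> (flip i x) i) (\<psi> (flip i x))"
      using \<rho>[of "flip i x" i] x ij by simp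
    then have "flip (\<rho> x i) (\<psi> (flip i x)) = flip (\<rho> (flip i x) i) (\<psi> (flip i x))"
      using \<rho>[OF x ij(1)] by simp
    then have "\<rho> x i = \<rho> (flip i x) i"
      using \<rho>[OF x ij(1)] x ij by (intro flip_inject[of "\<psi> (flip i x)" N]) (simp_all add: mem)
    then show ?thesis using True by simp
  next
    case False
    define y p q r s where defs: "y = \<psi> x" "p = \<rho> x i" "q = \<rho> x j"
      "r = \<rho> (flip i x) j" "s = \<rho> (flip j x) i"
    have pq: "p \<noteq> q" "p < N" "q < N" using \<rho>_inj False \<rho> x ij by (auto simp: defs)
    have yH: "y \<in> hypercube N" using mem x by (simp add: defs)
    have comm: "flip j (flip i x) = flip i (flip j x)"
      using False by (auto simp: flip_apply fun_eq_iff)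
    have z1: "\<psi> (flip j (flip i x)) = flip r (flip p y)"
      using \<rho>[of "flip i x" j] \<rho>[of x i] x ij by (simp add: defs)
    have z2: "\<psi> (flip j (flip i x)) = flip s (flip q y)"
      using \<rho>[of "flip j x" i] \<rho>[of x j] x ij by (simp add: defs comm)
    have "flip j (flip i x) \<noteq> x"
      using False hypercube_value[OF x ij(1)] by (auto simp: flip_apply fun_eq_iff)
    then have "\<psi> (flip j (flip i x)) \<noteq> y"
      using inj[of "flip j (flip i x)" x] x ij by (auto simp: defs)
    then have "s \<noteq> q" using z2 by auto
    moreover have "flip r (flip p y) q = flip s (flip q y) q" using z1 z2 by simp
    ultimately have "r = q"
      using pq hypercube_value[OF yH pq(3)] by (auto simp: flip_apply split: if_splits)
    then show ?thesis by (simp add: defs)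
  qed
  define one :: "nat \<Rightarrow> int" where "one = restrict (\<lambda>_. 1) {..<N}"
  have oneH: "one \<in> hypercube N" by (auto simp: one_def hypercube_def)
  have const: "\<forall>i<N. \<rho> x i = \<rho> one i" if "x \<in> hypercube N" for x
    using that
  proof (rule hypercube_connected[rotated 2])
    fix y assume "y \<in> hypercube N" "\<forall>i<N. y i = 1"
    then have "y = one"
      by (auto simp: hypercube_def one_def fun_eq_iff PiE_iff extensional_def)
    then show "\<forall>i<N. \<rho> y i = \<rho> one i" by simp
  next
    fix y i assume "y \<in> hypercube N" "i < N" "\<forall>i<N. \<rho> y i = \<rho> one i"
    then show "\<forall>j<N. \<rho> (flip i y) j = \<rho> one j" using local by simp
  qed
  show thesis
  proof (rule that)
    have "inj_on (\<rho> one) {..<N}" using \<rho>_inj oneH by (auto simp: inj_on_def)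
    moreover have "\<rho> one ` {..<N} \<subseteq> {..<N}" using \<rho> oneH by auto
    ultimately show "bij_betw (\<rho> one) {..<N} {..<N}"
      by (simp add: bij_betw_def endo_inj_surj)
    show "\<psi> (flip i x) = flip (\<rho> one i) (\<psi> x)" if "x \<in> hypercube N" "i < N" for x i
      using \<rho>[OF that] const[OF that(1)] that(2) by simp
  qed
qed

definition twin :: "nat \<Rightarrow> ((nat \<Rightarrow> int) \<Rightarrow> int) \<Rightarrow> nat \<Rightarrow> nat \<Rightarrow> bool" where
  "twin N f i j \<longleftrightarrow> (\<forall>x\<in>hypercube N. sensitive f x i \<longleftrightarrow> sensitive f x j)"

text \<open>Directions that are sensitive everywhere or nowhere are left out: each of these two sorts forms
  a single twin class, whose size could coincide with a size that is to be detected.\<close>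

definition twin_sizes :: "nat \<Rightarrow> ((nat \<Rightarrow> int) \<Rightarrow> int) \<Rightarrow> nat set" where
  "twin_sizes N f = (\<lambda>i. card {j \<in> {..<N}. twin N f i j}) `
     {i \<in> {..<N}. (\<exists>x\<in>hypercube N. sensitive f x i) \<and> (\<exists>x\<in>hypercube N. \<not> sensitive f x i)}"

lemma twin_sizes_isomorphic:
  assumes "isomorphic N f g"
  shows "twin_sizes N f = twin_sizes N g"
proof -
  let ?nonconst = "\<lambda>f. {i \<in> {..<N}. (\<exists>x\<in>hypercube N. sensitive f x i) \<and>
    (\<exists>x\<in>hypercube N. \<not> sensitive f x i)}"
  obtain \<psi> where aut: "cube_automorphism N \<psi>" and fg: "\<And>x. x \<in> hypercube N \<Longrightarrow> f (\<psi> x) = g x"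
    using assms by (auto simp: isomorphic_def)
  obtain \<pi> where \<pi>: "bij_betw \<pi> {..<N} {..<N}"
    "\<And>x i. x \<in> hypercube N \<Longrightarrow> i < N \<Longrightarrow> \<psi> (flip i x) = flip (\<pi> i) (\<psi> x)"
    using automorphism_directions[OF aut] by blast
  have img: "\<psi> ` hypercube N = hypercube N"
    using aut by (auto simp: cube_automorphism_def bij_betw_def)
  have pimg: "\<pi> ` {..<N} = {..<N}" and pinj: "inj_on \<pi> {..<N}"
    using \<pi>(1) by (auto simp: bij_betw_def)
  have transport: "A = \<pi> ` B"
    if "A \<subseteq> {..<N}" "B \<subseteq> {..<N}" "\<And>i. i < N \<Longrightarrow> \<pi> i \<in> A \<longleftrightarrow> i \<in> B" for A B
  proof
    show "A \<subseteq> \<pi> ` B"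
    proof
      fix k assume "k \<in> A"
      then have "k \<in> \<pi> ` {..<N}" using that(1) pimg by blast
      then show "k \<in> \<pi> ` B" using that(3) \<open>k \<in> A\<close> by blast
    qed
    show "\<pi> ` B \<subseteq> A" using that(2,3) by blast
  qed
  have sens: "sensitive f (\<psi> x) (\<pi> i) \<longleftrightarrow> sensitive g x i" if "x \<in> hypercube N" "i < N" for x i
    using that fg fg[of "flip i x"] \<pi>(2)[OF that] by (simp add: sensitive_def)
  have all: "(\<forall>x\<in>hypercube N. P x) \<longleftrightarrow> (\<forall>x\<in>hypercube N. P (\<psi> x))" for P
    using ball_simps(9)[of \<psi> "hypercube N" P] unfolding img .
  have always: "(\<forall>x\<in>hypercube N. sensitive f x (\<pi> i)) \<longleftrightarrow> (\<forall>x\<in>hypercube N. sensitive g x i)"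
    if "i < N" for i
    unfolding all[of "\<lambda>x. sensitive f x (\<pi> i)"] using sens[OF _ that] by (intro ball_cong) simp_all
  have never: "(\<forall>x\<in>hypercube N. \<not> sensitive f x (\<pi> i)) \<longleftrightarrow> (\<forall>x\<in>hypercube N. \<not> sensitive g x i)"
    if "i < N" for i
    unfolding all[of "\<lambda>x. \<not> sensitive f x (\<pi> i)"] using sens[OF _ that] by (intro ball_cong) simp_all
  have mixed: "\<pi> i \<in> ?nonconst f \<longleftrightarrow> i \<in> ?nonconst g" if "i < N" for i
  proof -
    have "\<pi> i < N" using pimg that by blast
    moreover have "(\<exists>x\<in>hypercube N. sensitive f x (\<pi> i)) \<longleftrightarrow> (\<exists>x\<in>hypercube N. sensitive g x i)"
      using never[OF that] by blast
    moreover have "(\<exists>x\<in>hypercube N. \<not> sensitive f x (\<pi> i)) \<longleftrightarrow> (\<exists>x\<in>hypercube N. \<not> sensitive g x i)"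
      using always[OF that] by blast
    ultimately show ?thesis using that by simp
  qed
  have nonconst: "?nonconst f = \<pi> ` ?nonconst g"
    by (rule transport) (blast, blast, rule mixed)
  have tw: "twin N f (\<pi> i) (\<pi> j) \<longleftrightarrow> twin N g i j" if "i < N" "j < N" for i j
    unfolding twin_def all[of "\<lambda>x. sensitive f x (\<pi> i) = sensitive f x (\<pi> j)"]
    using sens[OF _ that(1)] sens[OF _ that(2)] by (intro ball_cong) simp_all
  have "card {j \<in> {..<N}. twin N f (\<pi> i) j} = card {j \<in> {..<N}. twin N g i j}" if "i < N" for i
  proof -
    have "{j \<in> {..<N}. twin N f (\<pi> i) j} = \<pi> ` {j \<in> {..<N}. twin N g i j}"
      using tw[OF that] pimg by (intro transport) auto
    then show ?thesis
      using card_image[OF inj_on_subset[OF pinj, of "{j \<in> {..<N}. twin N g i j}"]] by auto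
  qed
  then show ?thesis
    unfolding twin_sizes_def nonconst image_image by (intro image_cong) auto
qed

section \<open>The block functions\<close>

text \<open>Block \<open>t\<close> occupies the \<open>2 t + 2\<close> coordinates from \<open>off t\<close> on: first the \<open>t\<close> factors of \<open>a\<close>, then the
  \<open>t\<close> factors of \<open>b\<close>, then \<open>x\<close> and \<open>y\<close>.\<close>

definition off :: "nat \<Rightarrow> nat" where
  "off t = t * (t + 1)"

lemma off_Suc: "off (Suc t) = off t + 2 * t + 2"
  by (simp add: off_def)

lemma off_mono: "s \<le> t \<Longrightarrow> off s \<le> off t"
  unfolding off_def by (intro mult_le_mono) auto

lemma off_disjoint:
  assumes "off t \<le> i" "i < off (Suc t)" "off s \<le> i" "i < off (Suc s)"
  shows "s = t"
proof (rule ccontr)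
  assume "s \<noteq> t"
  then have "Suc s \<le> t \<or> Suc t \<le> s" by auto
  then show False using off_mono assms by (metis leD le_trans)
qed

lemma off_cover:
  assumes "i < off K"
  obtains t where "t < K" "off t \<le> i" "i < off (Suc t)"
proof -
  have "\<exists>t<K. off t \<le> i \<and> i < off (Suc t)"
    using assms
  proof (induction K)
    case 0
    then show ?case by (simp add: off_def)
  next
    case (Suc K)
    show ?case
    proof (cases "i < off K")
      case True
      then show ?thesis using Suc.IH less_SucI by blast
    next
      case False
      then show ?thesis using Suc.prems by (intro exI[of _ K]) simp
    qed
  qed
  then show thesis using that by blast
qed

definition block :: "nat \<Rightarrow> nat" where
  "block i = (THE t. off t \<le> i \<and> i < off (Suc t))"

lemma block_eq: "off t \<le> i \<Longrightarrow> i < off (Suc t) \<Longrightarrow> block i = t"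
  unfolding block_def by (rule the_equality) (auto intro: off_disjoint)

definition prodA :: "nat \<Rightarrow> (nat \<Rightarrow> int) \<Rightarrow> int" where
  "prodA t x = prod x {off t..<off t + t}"

definition prodB :: "nat \<Rightarrow> (nat \<Rightarrow> int) \<Rightarrow> int" where
  "prodB t x = prod x {off t + t..<off t + 2 * t}"

definition block_value :: "nat set \<Rightarrow> nat \<Rightarrow> (nat \<Rightarrow> int) \<Rightarrow> int" where
  "block_value S t x = prodA t x *
     (if t \<in> S \<and> prodA t x \<noteq> prodB t x then x (off t + 2 * t + 1) else x (off t + 2 * t))"

text \<open>A direction of a block is sensitive always, never, or according to the truth value of \<open>x = y\<close>
  (\<open>Tails\<close>) or of \<open>a = b\<close> (\<open>Prods\<close>) in that block.  Naming these conditions symbolically reduces the comparison of directions to a comparison of terms.\<close>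

datatype condition = Fixed bool | Tails nat bool | Prods nat bool

fun holds :: "(nat \<Rightarrow> int) \<Rightarrow> condition \<Rightarrow> bool" where
  "holds x (Fixed c) = c"
| "holds x (Tails t c) = ((x (off t + 2 * t) = x (off t + 2 * t + 1)) = c)"
| "holds x (Prods t c) = ((prodA t x = prodB t x) = c)"

lemma prod_flip:
  assumes "finite I"
  shows "prod (flip i x) I = (if i \<in> I then - prod x I else prod x I)"
proof (cases "i \<in> I")
  case True
  have "prod (flip i x) (I - {i}) = prod x (I - {i})"
    by (rule prod.cong) (auto simp: flip_apply)
  then show ?thesis using True assms
    by (simp add: prod.remove[of I i] flip_apply)
next
  case False
  then show ?thesis by (auto simp: flip_apply intro!: prod.cong)
qed

lemma prodA_flip:
  "prodA t (flip i x) = (if off t \<le> i \<and> i < off t + t then - prodA t x else prodA t x)"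
  by (simp add: prodA_def prod_flip)

lemma prodB_flip:
  "prodB t (flip i x) = (if off t + t \<le> i \<and> i < off t + 2 * t then - prodB t x else prodB t x)"
  by (simp add: prodB_def prod_flip)

lemma prod_signs:
  assumes "\<And>i. i \<in> I \<Longrightarrow> x i = 1 \<or> x i = (-1::int)"
  shows "prod x I = 1 \<or> prod x I = -1"
  using assms
proof (induction I rule: infinite_finite_induct)
  case (insert i I)
  then have "x i = 1 \<or> x i = -1" "prod x I = 1 \<or> prod x I = -1" by blast+
  then show ?case using insert.hyps by auto
qed auto

text \<open>Blocks 0 and 1 are always of the first kind: for \<open>t = 0\<close> the two kinds coincide, and a twin
  class of size 1 cannot be told apart from the classes \<open>{x}\<close> and \<open>{y}\<close> of other blocks.  The \<open>M\<close> coordinates after the last block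
  enter as plain factors, and all later ones are ignored.\<close>

locale block_functions =
  fixes N K M :: nat and S :: "nat set"
  assumes room: "off K + M \<le> N" and S: "S \<subseteq> {2..<K}"
begin

definition total :: "(nat \<Rightarrow> int) \<Rightarrow> int" where
  "total x = (\<Prod>t<K. block_value S t x) * prod x {off K..<off K + M}"

definition fn :: "(nat \<Rightarrow> int) \<Rightarrow> int" where
  "fn = restrict total (hypercube N)"

definition cond :: "nat \<Rightarrow> condition" where
  "cond i = (if i < off K then
     (let t = block i in
       if t \<in> S then
         (if i < off t + t then Tails t True
          else if i < off t + 2 * t then Tails t False
          else if i = off t + 2 * t then Prods t True
          else Prods t False)
       else Fixed (i < off t + t \<or> i = off t + 2 * t))
     else Fixed (i < off K + M))"

lemma block_inside: "t < K \<Longrightarrow> i < off (Suc t) \<Longrightarrow> i < off K"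
  using off_mono[of "Suc t" K] by simp

lemma cond_block:
  assumes "t < K" "off t \<le> i" "i < off (Suc t)"
  shows "cond i = (if t \<in> S then
         (if i < off t + t then Tails t True
          else if i < off t + 2 * t then Tails t False
          else if i = off t + 2 * t then Prods t True
          else Prods t False)
       else Fixed (i < off t + t \<or> i = off t + 2 * t))"
  using assms block_inside[of t i] by (simp add: cond_def block_eq Let_def)

lemma signs:
  assumes x: "x \<in> hypercube N" and t: "t < K"
  shows "prodA t x = 1 \<or> prodA t x = -1" "prodB t x = 1 \<or> prodB t x = -1"
    "x (off t + 2 * t) = 1 \<or> x (off t + 2 * t) = -1"
    "x (off t + 2 * t + 1) = 1 \<or> x (off t + 2 * t + 1) = -1"
proof -
  have *: "x i = 1 \<or> x i = -1" if "i < off (Suc t)" for i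
    using hypercube_value[OF x] block_inside[OF t that] room by simp
  show "prodA t x = 1 \<or> prodA t x = -1"
    unfolding prodA_def by (rule prod_signs, rule *) (simp add: off_Suc)
  show "prodB t x = 1 \<or> prodB t x = -1"
    unfolding prodB_def by (rule prod_signs, rule *) (simp add: off_Suc)
  show "x (off t + 2 * t) = 1 \<or> x (off t + 2 * t) = -1"
    by (rule *) (simp add: off_Suc)
  show "x (off t + 2 * t + 1) = 1 \<or> x (off t + 2 * t + 1) = -1"
    by (rule *) (simp add: off_Suc)
qed

lemma block_value_sign:
  assumes "x \<in> hypercube N" "t < K"
  shows "block_value S t x = 1 \<or> block_value S t x = -1"
  using signs[OF assms] by (auto simp: block_value_def)

lemma prod_nonzero:
  assumes "x \<in> hypercube N" "T \<subseteq> {..<K}"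
  shows "(\<Prod>t\<in>T. block_value S t x) \<noteq> 0"
proof -
  have "block_value S t x \<noteq> 0" if "t \<in> T" for t
    using block_value_sign[OF assms(1), of t] that assms(2) by fastforce
  then show ?thesis using finite_subset[OF assms(2)] by (simp add: prod_zero_iff)
qed

lemma rest_sign:
  assumes "x \<in> hypercube N"
  shows "prod x {off K..<off K + M} = 1 \<or> prod x {off K..<off K + M} = -1"
  using hypercube_value[OF assms] room by (intro prod_signs) auto

lemma block_value_flip_other:
  assumes "\<not> (off t \<le> i \<and> i < off (Suc t))"
  shows "block_value S t (flip i x) = block_value S t x"
  using assms by (auto simp: block_value_def prodA_flip prodB_flip flip_apply off_Suc)

text \<open>For a block \<open>a * (if a = b then x else y)\<close>: negating a factor of \<open>a\<close> turns \<open>a x\<close> into \<open>- a y\<close> or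
  vice versa, so the value changes iff \<open>x = y\<close>.  Negating a factor of \<open>b\<close> exchanges \<open>a x\<close> and \<open>a y\<close>, so
  the value changes iff \<open>x \<noteq> y\<close>.  Negating \<open>x\<close> or \<open>y\<close> matters iff that coordinate is selected.\<close>

lemma block_value_flip:
  assumes x: "x \<in> hypercube N" and t: "t < K" and i: "off t \<le> i" "i < off (Suc t)"
  shows "block_value S t (flip i x) \<noteq> block_value S t x \<longleftrightarrow> holds x (cond i)"
proof -
  define a b u v where abuv: "a = prodA t x" "b = prodB t x"
    "u = x (off t + 2 * t)" "v = x (off t + 2 * t + 1)"
  have pm: "a = 1 \<or> a = -1" "b = 1 \<or> b = -1" "u = 1 \<or> u = -1" "v = 1 \<or> v = -1"
    using signs[OF x t] by (simp_all add: abuv)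
  have before: "block_value S t x = a * (if t \<in> S \<and> a \<noteq> b then v else u)"
    by (simp add: block_value_def abuv)
  note flipped = block_value_def prodA_flip prodB_flip flip_apply
  consider "i < off t + t" | "off t + t \<le> i" "i < off t + 2 * t"
    | "i = off t + 2 * t" | "i = off t + 2 * t + 1"
    using i by (fastforce simp: off_Suc)
  then show ?thesis
  proof cases
    case 1
    then have "block_value S t (flip i x) = - a * (if t \<in> S \<and> - a \<noteq> b then v else u)"
      using i by (simp add: abuv flipped)
    moreover have "holds x (cond i) \<longleftrightarrow> t \<notin> S \<or> u = v"
      using 1 by (simp add: cond_block[OF t i] abuv)
    ultimately show ?thesis unfolding before using pm by (elim disjE) simp_all
  next
    case 2
    then have "block_value S t (flip i x) = a * (if t \<in> S \<and> a \<noteq> - b then v else u)"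
      using i by (simp add: abuv flipped)
    moreover have "holds x (cond i) \<longleftrightarrow> t \<in> S \<and> u \<noteq> v"
      using 2 by (simp add: cond_block[OF t i] abuv)
    ultimately show ?thesis unfolding before using pm by (elim disjE) simp_all
  next
    case 3
    then have "block_value S t (flip i x) = a * (if t \<in> S \<and> a \<noteq> b then v else - u)"
      using i by (simp add: abuv flipped)
    moreover have "holds x (cond i) \<longleftrightarrow> t \<notin> S \<or> a = b"
      using cond_block[OF t i] 3 by (simp add: abuv)
    ultimately show ?thesis unfolding before using pm by (elim disjE) simp_all
  next
    case 4
    then have "block_value S t (flip i x) = a * (if t \<in> S \<and> a \<noteq> b then - v else u)"
      using i by (simp add: abuv flipped)
    moreover have "holds x (cond i) \<longleftrightarrow> t \<in> S \<and> a \<noteq> b"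
      using cond_block[OF t i] 4 by (simp add: abuv)
    ultimately show ?thesis unfolding before using pm by (elim disjE) simp_all
  qed
qed

lemma sensitive_fn:
  assumes x: "x \<in> hypercube N" and i: "i < N"
  shows "sensitive fn x i \<longleftrightarrow> holds x (cond i)"
proof (cases "i < off K")
  case True
  then obtain t where t: "t < K" "off t \<le> i" "i < off (Suc t)"
    using off_cover by blast
  let ?Z = "\<lambda>x. (\<Prod>s\<in>{..<K} - {t}. block_value S s x) * prod x {off K..<off K + M}"
  have split: "total y = block_value S t y * ?Z y" for y
    using t by (simp add: total_def prod.remove[of "{..<K}" t])
  have "(\<Prod>s\<in>{..<K} - {t}. block_value S s (flip i x)) = (\<Prod>s\<in>{..<K} - {t}. block_value S s x)"
    using off_disjoint[OF t(2,3)] by (intro prod.cong refl block_value_flip_other) auto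
  then have Z: "?Z (flip i x) = ?Z x" using True by (simp add: prod_flip)
  have "(\<Prod>s\<in>{..<K} - {t}. block_value S s x) \<noteq> 0"
    by (rule prod_nonzero[OF x]) simp
  moreover have "prod x {off K..<off K + M} \<noteq> 0" using rest_sign[OF x] by presburger
  ultimately have "?Z x \<noteq> 0" by (simp only: mult_eq_0_iff simp_thms)
  then have "total (flip i x) \<noteq> total x \<longleftrightarrow> block_value S t (flip i x) \<noteq> block_value S t x"
    unfolding split Z by simp
  then show ?thesis
    using block_value_flip[OF x t] x i by (simp add: sensitive_def fn_def)
next
  case False
  have "block_value S t (flip i x) = block_value S t x" if "t < K" for t
    using False that block_inside[OF that] by (intro block_value_flip_other) auto
  then have eq: "(\<Prod>t<K. block_value S t (flip i x)) = (\<Prod>t<K. block_value S t x)" by simp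
  have "(\<Prod>t<K. block_value S t x) \<noteq> 0"
    using prod_nonzero[OF x] by blast
  moreover have "prod x {off K..<off K + M} \<noteq> 0" using rest_sign[OF x] by presburger
  ultimately have "total (flip i x) \<noteq> total x \<longleftrightarrow> i < off K + M"
    using False unfolding total_def eq by (auto simp: prod_flip)
  then show ?thesis using False x i by (simp add: sensitive_def fn_def cond_def)
qed

lemma fn_boolean: "fn \<in> boolean_functions N"
proof -
  have "total x \<in> {-1, 1}" if x: "x \<in> hypercube N" for x
    using prod_signs[of "{..<K}" "\<lambda>t. block_value S t x"] block_value_sign[OF x] rest_sign[OF x]
    by (auto simp: total_def)
  then show ?thesis by (auto simp: boolean_functions_def fn_def)
qed

text \<open>In a block of the second kind exactly one of the two groups of \<open>t\<close> factors is sensitive, and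
  exactly one of \<open>x\<close> and \<open>y\<close>; in a block of the first kind it is the factors of \<open>a\<close>, and \<open>x\<close>.\<close>

lemma card_holds_block:
  assumes "t < K"
  shows "card {i \<in> {off t..<off (Suc t)}. holds x (cond i)} = t + 1"
proof -
  define p q where pq: "p \<longleftrightarrow> t \<in> S \<and> x (off t + 2 * t) \<noteq> x (off t + 2 * t + 1)"
    "q \<longleftrightarrow> t \<in> S \<and> prodA t x \<noteq> prodB t x"
  define J where "J = (if p then {off t + t..<off t + 2 * t} else {off t..<off t + t})"
  define k where "k = (if q then off t + 2 * t + 1 else off t + 2 * t)"
  have "holds x (cond i) \<longleftrightarrow>
      (if i < off t + t then \<not> p else if i < off t + 2 * t then p
       else if i = off t + 2 * t then \<not> q else q)"
    if "off t \<le> i" "i < off (Suc t)" for i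
    by (simp add: cond_block[OF assms that] pq)
  then have "{i \<in> {off t..<off (Suc t)}. holds x (cond i)} =
      {i \<in> {off t..<off (Suc t)}. if i < off t + t then \<not> p else if i < off t + 2 * t then p
       else if i = off t + 2 * t then \<not> q else q}"
    by (intro Collect_cong) auto
  also have "\<dots> = insert k J"
    by (cases p; cases q; rule set_eqI) (simp_all add: J_def k_def off_Suc, arith+)
  finally show ?thesis by (simp add: J_def k_def)
qed

lemma card_holds_blocks:
  "k \<le> K \<Longrightarrow> 2 * card {i \<in> {..<off k}. holds x (cond i)} = off k"
proof (induction k)
  case 0 then show ?case by (simp add: off_def)
next
  case (Suc k)
  define A where "A = {i \<in> {..<off k}. holds x (cond i)}"
  define B where "B = {i \<in> {off k..<off (Suc k)}. holds x (cond i)}"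
  have "{..<off (Suc k)} = {..<off k} \<union> {off k..<off (Suc k)}"
    using off_mono[of k "Suc k"] by (simp add: ivl_disj_un_one(2))
  then have "{i \<in> {..<off (Suc k)}. holds x (cond i)} = A \<union> B"
    unfolding A_def B_def by blast
  moreover have "A \<inter> B = {}" "finite A" "finite B"
    by (auto simp: A_def B_def)
  moreover have "card B = k + 1"
    unfolding B_def using card_holds_block Suc.prems by simp
  moreover have "2 * card A = off k"
    unfolding A_def using Suc by simp
  ultimately show ?case by (simp add: card_Un_disjoint off_Suc)
qed

lemma card_sensitive:
  assumes "x \<in> hypercube N"
  shows "card {i \<in> {..<N}. sensitive fn x i} = off K div 2 + M"
proof -
  let ?A = "{i \<in> {..<off K}. holds x (cond i)}"
  have "{i \<in> {..<N}. sensitive fn x i} = {i \<in> {..<N}. holds x (cond i)}"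
    using sensitive_fn[OF assms] by (intro Collect_cong) auto
  also have "\<dots> = ?A \<union> {off K..<off K + M}"
  proof (rule set_eqI)
    fix i
    show "i \<in> {i \<in> {..<N}. holds x (cond i)} \<longleftrightarrow> i \<in> ?A \<union> {off K..<off K + M}"
      using room by (cases "i < off K") (auto simp: cond_def)
  qed
  also have "card \<dots> = card ?A + card {off K..<off K + M}"
    by (rule card_Un_disjoint) auto
  also have "\<dots> = off K div 2 + M" using card_holds_blocks[of K x] by simp
  finally show ?thesis .
qed

text \<open>Three kinds of vertices suffice to separate all conditions: the all-ones vertex, where \<open>x = y\<close>
  and \<open>a = b\<close> in every block, and its neighbours that violate exactly one of these equations in
  exactly one block.  The coordinate \<open>off t + 2 * t + 1\<close> is \<open>y\<close> of block \<open>t\<close>, and \<open>off t + t\<close> is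
  the first factor of \<open>b\<close>.\<close>

definition one :: "nat \<Rightarrow> int" where "one = restrict (\<lambda>_. 1) {..<N}"

lemma one_in [simp]: "one \<in> hypercube N"
  by (auto simp: one_def hypercube_def)

fun proper :: "condition \<Rightarrow> bool" where
  "proper (Fixed _) = False"
| "proper (Tails t _) = (t \<in> S)"
| "proper (Prods t _) = (t \<in> S)"

lemma cond_cases: "(\<exists>c. cond i = Fixed c) \<or> proper (cond i)"
  by (auto simp: cond_def Let_def)

lemma S_bounds: "t \<in> S \<Longrightarrow> 2 \<le> t \<and> t < K"
  using S by auto

lemma one_block:
  assumes "t < K"
  shows "prodA t one = 1" "prodB t one = 1" "one (off t + 2 * t) = 1" "one (off t + 2 * t + 1) = 1"
proof -
  have "one i = 1" if "i < off (Suc t)" for i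
    using block_inside[OF assms that] room by (simp add: one_def)
  then show "prodA t one = 1" "prodB t one = 1" "one (off t + 2 * t) = 1" "one (off t + 2 * t + 1) = 1"
    unfolding prodA_def prodB_def by (auto intro!: prod.neutral simp: off_Suc)
qed

lemma holds_one:
  assumes "s \<in> S"
  shows "holds one (Tails s c) = c" "holds one (Prods s c) = c"
  using one_block[of s] S_bounds[OF assms] by auto

lemma holds_flip_one:
  assumes "t \<in> S" "s \<in> S"
  shows "holds (flip (off t + 2 * t + 1) one) (Tails s c) = ((s \<noteq> t) = c)"
    "holds (flip (off t + 2 * t + 1) one) (Prods s c) = c"
    "holds (flip (off t + t) one) (Tails s c) = c"
    "holds (flip (off t + t) one) (Prods s c) = ((s \<noteq> t) = c)"
proof -
  have t: "2 \<le> t" "t < K" and s: "s < K" using S_bounds assms by auto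
  have far: "i < off s \<or> off (Suc s) \<le> i" if "s \<noteq> t" "off t \<le> i" "i < off (Suc t)" for i
    using off_disjoint[OF that(2,3), of s] that(1) not_le by blast
  have ys: "off t + 2 * t + 1 < off s \<or> off (Suc s) \<le> off t + 2 * t + 1" if "s \<noteq> t"
    using far[OF that, of "off t + 2 * t + 1"] by (simp add: off_Suc)
  have bs: "off t + t < off s \<or> off (Suc s) \<le> off t + t" if "s \<noteq> t"
    using far[OF that, of "off t + t"] by (simp add: off_Suc)
  have *: "prodA s (flip (off t + 2 * t + 1) one) = 1"
    "prodB s (flip (off t + 2 * t + 1) one) = 1"
    "flip (off t + 2 * t + 1) one (off s + 2 * s) = 1"
    "flip (off t + 2 * t + 1) one (off s + 2 * s + 1) = (if s = t then -1 else 1)"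
    by (cases "s = t"; use one_block[OF s] ys in \<open>auto simp: prodA_flip prodB_flip flip_apply off_Suc\<close>)+
  have **: "prodA s (flip (off t + t) one) = 1"
    "prodB s (flip (off t + t) one) = (if s = t then -1 else 1)"
    "flip (off t + t) one (off s + 2 * s) = 1"
    "flip (off t + t) one (off s + 2 * s + 1) = 1"
    by (cases "s = t"; use one_block[OF s] bs t in \<open>auto simp: prodA_flip prodB_flip flip_apply off_Suc\<close>)+
  show "holds (flip (off t + 2 * t + 1) one) (Tails s c) = ((s \<noteq> t) = c)"
    "holds (flip (off t + 2 * t + 1) one) (Prods s c) = c"
    using * by (auto simp del: flip_apply)
  show "holds (flip (off t + t) one) (Tails s c) = c"
    "holds (flip (off t + t) one) (Prods s c) = ((s \<noteq> t) = c)"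
    using ** by auto
qed

lemma flip_one_in:
  assumes "t \<in> S"
  shows "flip (off t + 2 * t + 1) one \<in> hypercube N" "flip (off t + t) one \<in> hypercube N"
proof -
  have "off (Suc t) \<le> N" using S_bounds[OF assms] off_mono[of "Suc t" K] room by simp
  then show "flip (off t + 2 * t + 1) one \<in> hypercube N" "flip (off t + t) one \<in> hypercube N"
    by (auto simp: off_Suc)
qed

lemma proper_not_constant:
  assumes "proper L"
  shows "\<exists>x\<in>hypercube N. holds x L = b"
proof -
  obtain y where y: "y \<in> hypercube N" "holds y L \<noteq> holds one L"
  proof (cases L)
    case (Fixed c)
    then show ?thesis using assms by simp
  next
    case (Tails t c)
    then have t: "t \<in> S" using assms by simp
    show ?thesis
      by (rule that[OF flip_one_in(1)[OF t]])
        (simp only: Tails holds_one[OF t] holds_flip_one[OF t t], simp)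
  next
    case (Prods t c)
    then have t: "t \<in> S" using assms by simp
    show ?thesis
      by (rule that[OF flip_one_in(2)[OF t]])
        (simp only: Prods holds_one[OF t] holds_flip_one[OF t t], simp)
  qed
  show ?thesis
  proof (cases "holds one L = b")
    case True
    then show ?thesis using one_in by blast
  next
    case False
    then have "holds y L = b" using y(2) by blast
    then show ?thesis using y(1) by blast
  qed
qed

lemma conditions_distinguished:
  assumes "proper L" "proper L'" "\<And>x. x \<in> hypercube N \<Longrightarrow> holds x L = holds x L'"
  shows "L = L'"
proof -
  have at_one: "holds one L = holds one L'" by (rule assms(3)[OF one_in])
  show ?thesis
  proof (cases L)
    case (Fixed c)
    then show ?thesis using assms(1) by simp
  next
    case L: (Tails t c)
    then have t: "t \<in> S" using assms(1) by simp
    note at_flip = assms(3)[OF flip_one_in(1)[OF t], unfolded L]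
    show ?thesis
    proof (cases L')
      case (Fixed d)
      then show ?thesis using assms(2) by simp
    next
      case (Tails s d)
      then have s: "s \<in> S" using assms(2) by simp
      show ?thesis
        using at_one at_flip unfolding L Tails holds_one[OF s] holds_one[OF t]
          holds_flip_one(1,2)[OF t s] holds_flip_one(1,2)[OF t t] by auto
    next
      case (Prods s d)
      then have s: "s \<in> S" using assms(2) by simp
      show ?thesis
        using at_one at_flip unfolding L Prods holds_one[OF s] holds_one[OF t]
          holds_flip_one(1,2)[OF t s] holds_flip_one(1,2)[OF t t] by auto
    qed
  next
    case L: (Prods t c)
    then have t: "t \<in> S" using assms(1) by simp
    note at_flip = assms(3)[OF flip_one_in(2)[OF t], unfolded L]
    show ?thesis
    proof (cases L')
      case (Fixed d)
      then show ?thesis using assms(2) by simp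
    next
      case (Tails s d)
      then have s: "s \<in> S" using assms(2) by simp
      show ?thesis
        using at_one at_flip unfolding L Tails holds_one[OF s] holds_one[OF t]
          holds_flip_one(3,4)[OF t s] holds_flip_one(3,4)[OF t t] by auto
    next
      case (Prods s d)
      then have s: "s \<in> S" using assms(2) by simp
      show ?thesis
        using at_one at_flip unfolding L Prods holds_one[OF s] holds_one[OF t]
          holds_flip_one(3,4)[OF t s] holds_flip_one(3,4)[OF t t] by auto
    qed
  qed
qed

lemma twin_fn_iff:
  assumes "i < N" "j < N" "proper (cond i)"
  shows "twin N fn i j \<longleftrightarrow> cond j = cond i"
proof
  assume "twin N fn i j"
  then have eq: "holds x (cond i) = holds x (cond j)" if "x \<in> hypercube N" for x
    using that assms sensitive_fn by (auto simp: twin_def)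
  have "proper (cond j)"
    using cond_cases[of j] proper_not_constant[OF assms(3)] eq by (metis holds.simps(1))
  then show "cond j = cond i" using conditions_distinguished[OF assms(3) _ eq] by metis
next
  assume "cond j = cond i"
  then show "twin N fn i j" using assms sensitive_fn by (auto simp: twin_def)
qed

lemma cond_class:
  assumes "t \<in> S" "t < K"
  shows "{j \<in> {..<N}. cond j = Tails t True} = {off t..<off t + t}"
    "{j \<in> {..<N}. cond j = Tails t False} = {off t + t..<off t + 2 * t}"
    "{j \<in> {..<N}. cond j = Prods t True} = {off t + 2 * t}"
    "{j \<in> {..<N}. cond j = Prods t False} = {off t + 2 * t + 1}"
proof -
  have outside: "cond j \<noteq> Tails t c \<and> cond j \<noteq> Prods t c"
    if j: "\<not> (off t \<le> j \<and> j < off (Suc t))" for j c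
  proof (cases "j < off K")
    case True
    then obtain s where s: "s < K" "off s \<le> j" "j < off (Suc s)" using off_cover by blast
    then have "s \<noteq> t" using j by blast
    then show ?thesis unfolding cond_block[OF s] by simp
  next
    case False
    then show ?thesis by (simp add: cond_def)
  qed
  have bound: "j < N" if "j < off (Suc t)" for j
    using block_inside[OF assms(2) that] room by simp
  have class_eq: "{j \<in> {..<N}. cond j = L} = I"
    if L: "L = Tails t c \<or> L = Prods t c" and I: "I \<subseteq> {off t..<off (Suc t)}"
      and on_block: "\<And>j. off t \<le> j \<Longrightarrow> j < off (Suc t) \<Longrightarrow> cond j = L \<longleftrightarrow> j \<in> I" for L c I
  proof (rule set_eqI)
    fix j
    show "j \<in> {j \<in> {..<N}. cond j = L} \<longleftrightarrow> j \<in> I"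
    proof (cases "off t \<le> j \<and> j < off (Suc t)")
      case True
      then show ?thesis using on_block[of j] bound[of j] by simp
    next
      case False
      then have "cond j \<noteq> L" using outside[OF False] L by blast
      moreover have "j \<notin> I" using I False by auto
      ultimately show ?thesis by blast
    qed
  qed
  have eq: "cond j = (if j < off t + t then Tails t True
          else if j < off t + 2 * t then Tails t False
          else if j = off t + 2 * t then Prods t True
          else Prods t False)" if "off t \<le> j" "j < off (Suc t)" for j
    using cond_block[OF assms(2) that] assms(1) by simp
  show "{j \<in> {..<N}. cond j = Tails t True} = {off t..<off t + t}"
    by (rule class_eq[of _ True]) (auto simp: eq off_Suc)
  show "{j \<in> {..<N}. cond j = Tails t False} = {off t + t..<off t + 2 * t}"
    by (rule class_eq[of _ False]) (auto simp: eq off_Suc)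
  show "{j \<in> {..<N}. cond j = Prods t True} = {off t + 2 * t}"
    by (rule class_eq[of _ True]) (auto simp: eq off_Suc)
  show "{j \<in> {..<N}. cond j = Prods t False} = {off t + 2 * t + 1}"
    by (rule class_eq[of _ False]) (auto simp: eq off_Suc)
qed

lemma twin_sizes_fn:
  "twin_sizes N fn = (\<lambda>i. card {j \<in> {..<N}. cond j = cond i}) ` {i \<in> {..<N}. proper (cond i)}"
proof -
  have "(\<exists>x\<in>hypercube N. sensitive fn x i) \<and> (\<exists>x\<in>hypercube N. \<not> sensitive fn x i)
      \<longleftrightarrow> proper (cond i)" if "i < N" for i
  proof
    assume "(\<exists>x\<in>hypercube N. sensitive fn x i) \<and> (\<exists>x\<in>hypercube N. \<not> sensitive fn x i)"
    then show "proper (cond i)" using cond_cases[of i] sensitive_fn that by fastforce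
  next
    assume "proper (cond i)"
    then show "(\<exists>x\<in>hypercube N. sensitive fn x i) \<and> (\<exists>x\<in>hypercube N. \<not> sensitive fn x i)"
      using proper_not_constant[of "cond i" True] proper_not_constant[of "cond i" False]
        sensitive_fn that by auto
  qed
  then have "{i \<in> {..<N}. (\<exists>x\<in>hypercube N. sensitive fn x i) \<and> (\<exists>x\<in>hypercube N. \<not> sensitive fn x i)}
      = {i \<in> {..<N}. proper (cond i)}"
    by blast
  moreover have "{j \<in> {..<N}. twin N fn i j} = {j \<in> {..<N}. cond j = cond i}"
    if "i < N" "proper (cond i)" for i
    using twin_fn_iff that by blast
  ultimately show ?thesis unfolding twin_sizes_def by (intro image_cong) auto
qed

lemma S_recovered: "S = {t \<in> twin_sizes N fn. 2 \<le> t}"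
proof (intro set_eqI iffI)
  fix t assume t: "t \<in> S"
  then have b: "2 \<le> t" "t < K" using S_bounds by auto
  have "off t \<in> {j \<in> {..<N}. cond j = Tails t True}"
    using b unfolding cond_class[OF t b(2)] by simp
  then have "off t < N" "cond (off t) = Tails t True" by auto
  then have "t \<in> twin_sizes N fn"
    unfolding twin_sizes_fn using t cond_class(1)[OF t b(2)]
    by (intro image_eqI[of _ _ "off t"]) auto
  then show "t \<in> {t \<in> twin_sizes N fn. 2 \<le> t}" using b by simp
next
  fix t assume "t \<in> {t \<in> twin_sizes N fn. 2 \<le> t}"
  then obtain i where i: "t = card {j \<in> {..<N}. cond j = cond i}" "proper (cond i)" "2 \<le> t"
    by (auto simp: twin_sizes_fn)
  then obtain s c where s: "s \<in> S" "cond i = Tails s c \<or> cond i = Prods s c"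
    by (cases "cond i") auto
  then show "t \<in> S"
    using i cond_class[OF s(1)] S_bounds[OF s(1)] by (cases c) auto
qed

end

section \<open>Counting\<close>

text \<open>For the largest admissible \<open>K\<close>, maximality gives \<open>2 m - 2 \<le> (K + 1) (K + 2) + 2\<close>, which is at
  most \<open>(K + 3)\<^sup>2\<close>.\<close>

lemma number_of_blocks:
  fixes m :: nat
  assumes "m > 1"
  obtains K where "off K \<le> 2 * m - 4" "sqrt (2 * real m - 2) \<le> real K + 3"
proof -
  define K where "K = (GREATEST K. off K \<le> 2 * m - 4)"
  have bound: "y \<le> 2 * m - 4" if "off y \<le> 2 * m - 4" for y
    using that by (simp add: off_def)
  have K: "off K \<le> 2 * m - 4"
    unfolding K_def by (rule GreatestI_nat[of _ 0 "2 * m - 4"]) (auto simp: off_def)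
  have "\<not> off (Suc K) \<le> 2 * m - 4"
    using Greatest_le_nat[of "\<lambda>K. off K \<le> 2 * m - 4" "Suc K" "2 * m - 4"] bound
    by (auto simp: K_def)
  then have "2 * m - 2 \<le> (K + 3)\<^sup>2"
    by (simp add: off_def power2_eq_square algebra_simps)
  then have "real (2 * m - 2) \<le> (real K + 3)\<^sup>2"
    by (metis (mono_tags) of_nat_add of_nat_le_iff of_nat_numeral of_nat_power)
  then have "2 * real m - 2 \<le> (real K + 3)\<^sup>2" using assms by (simp add: of_nat_diff)
  then have "sqrt (2 * real m - 2) \<le> real K + 3" by (intro real_le_lsqrt) auto
  then show thesis using K that by blast
qed

theorem mainTheorem16:
  shows "\<exists>C::real. C > 0 \<and>
    (\<forall>m n' :: nat. m > 1 \<longrightarrow> n' \<ge> 2 * m - 2 \<longrightarrow>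
      (\<exists>F. finite F \<and> F \<subseteq> boolean_functions n' \<and>
        (\<forall>f\<in>F. locally_stable n' ((real n' - real m) / real n') f) \<and>
        pairwise (\<lambda>f g. \<not> isomorphic n' f g) F \<and>
        real (card F) \<ge> C * (2 powr sqrt (2 * real m - 2) / (2 * real m - 2) powr (1 / 4))))"
proof (intro exI[of _ "1 / 32 :: real"] conjI allI impI)
  show "(0::real) < 1 / 32" by simp
next
  fix m N :: nat
  assume m: "m > 1" and N: "N \<ge> 2 * m - 2"
  obtain K where K: "off K \<le> 2 * m - 4" "sqrt (2 * real m - 2) \<le> real K + 3"
    using number_of_blocks[OF m] by blast
  define M where "M = m - off K div 2"
  have "even (off K)" by (simp add: off_def)
  then have deg: "off K div 2 + M = m" and room: "off K + M \<le> N"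
    using K(1) m N by (auto simp: M_def elim!: evenE)
  define F where "F = block_functions.fn N K M ` Pow {2..<K}"
  have bf: "block_functions N K M S" if "S \<in> Pow {2..<K}" for S
    using that room by unfold_locales auto
  show "\<exists>F. finite F \<and> F \<subseteq> boolean_functions N \<and>
        (\<forall>f\<in>F. locally_stable N ((real N - real m) / real N) f) \<and>
        pairwise (\<lambda>f g. \<not> isomorphic N f g) F \<and>
        real (card F) \<ge> 1 / 32 * (2 powr sqrt (2 * real m - 2) / (2 * real m - 2) powr (1 / 4))"
  proof (intro exI[of _ F] conjI ballI)
    show "finite F" by (simp add: F_def)
    show "F \<subseteq> boolean_functions N"
      using block_functions.fn_boolean[OF bf] by (auto simp: F_def)
    show "locally_stable N ((real N - real m) / real N) f" if "f \<in> F" for f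
      using that block_functions.card_sensitive[OF bf] deg
      by (auto simp: F_def intro!: locally_stable_if_constant_sensitivity)
    show "pairwise (\<lambda>f g. \<not> isomorphic N f g) F"
    proof (rule pairwiseI, rule notI)
      fix f g assume "f \<in> F" "g \<in> F" "f \<noteq> g" and iso: "isomorphic N f g"
      then obtain S T where ST: "S \<in> Pow {2..<K}" "T \<in> Pow {2..<K}"
          "f = block_functions.fn N K M S" "g = block_functions.fn N K M T"
        by (auto simp: F_def)
      have "S = T"
        using block_functions.S_recovered[OF bf[OF ST(1)]] block_functions.S_recovered[OF bf[OF ST(2)]]
          twin_sizes_isomorphic[OF iso] ST(3,4) by simp
      then show False using ST \<open>f \<noteq> g\<close> by simp
    qed
    have "inj_on (block_functions.fn N K M) (Pow {2..<K})"
      using block_functions.S_recovered[OF bf] by (intro inj_onI) metis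
    then have card: "card F = 2 ^ (K - 2)"
      by (simp add: F_def card_image card_Pow)
    \<comment> \<open>The constant is \<open>32 = 2 ^ 5\<close> because the exponent \<open>K + 3\<close> is at most \<open>5 + (K - 2)\<close>, also when
      \<open>K < 2\<close> and the difference is truncated.\<close>
    have root: "(2 * real m - 2) powr (1 / 4) \<ge> 1"
      using m by (intro ge_one_powr_ge_zero) auto
    have "2 powr sqrt (2 * real m - 2) / (2 * real m - 2) powr (1 / 4)
        \<le> 2 powr sqrt (2 * real m - 2)"
      using root by (simp add: divide_le_eq mult_left_le order_trans)
    also have "\<dots> \<le> 2 powr (5 + real (K - 2))"
      using K(2) by (intro powr_mono) auto
    also have "\<dots> = 32 * 2 ^ (K - 2)" by (simp add: powr_add powr_realpow)
    finally show "real (card F) \<ge> 1 / 32 * (2 powr sqrt (2 * real m - 2) / (2 * real m - 2) powr (1 / 4))"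
      by (simp add: card)
  qed
qed

end
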